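(* There exist universal constants $\tilde c,\tilde C>0$ such that the following holds. Let $K>0$, let $n\ge \tilde C$ be an integer, and let $t>0$. Then there exist a vector $X=(X_1,X_2,\dots,X_n)$ of independent $K$-subgaussian real random variables and a convex function $f:\mathbb{R}^n\to\mathbb{R}$, $1$-Lipschitz with respect to the Euclidean metric, such that $$ \mathbb{P}\big\{f(X)-\mathrm{Med}\,f(X)\ge t\big\}\ge \tilde c\exp\left(-\frac{\tilde C\,t^2}{K^2\log\left(2+\frac{K^2n}{t^2}\right)}\right) $$ and $$ \mathbb{P}\big\{f(X)-\mathrm{Med}\,f(X)\le -t\big\}\ge \tilde c\exp\left(-\frac{\tilde C\,t^2}{K^2\log\left(2+\frac{K^2n}{t^2}\right)}\right). $$
   Context: For a real random variable $Y$, $\|Y\|_{\psi_2}:=\inf\{\lambda>0:\ \mathbb{E}\exp(Y^2/\lambda^2)\le 2\}$. $Y$ is called $K$-subgaussian if $\|Y\|_{\psi_2}\le K$. $\mathrm{Med}\,Y$ denotes a median of $Y$, i.e. a number $m$ with $\mathbb{P}\{Y\ge m\}\ge 1/2$ and $\mathbb{P}\{Y\le m\}\ge 1/2$. "Universal constant" means a constant not depending on any of the other parameters or objects. $\log$ is the natural logarithm. *)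

theory Defs
  imports "HOL-Probability.Probability"
begin

(* The value is ennreal, so that the infimum of the empty set is infinite (the infimum of the
   empty set of reals is an unspecified real), and the expectation is a nonnegative integral,
   which is infinite when exp (Y^2 / r^2) is not integrable. *)
definition psi2_norm :: "'a measure \<Rightarrow> ('a \<Rightarrow> real) \<Rightarrow> ennreal" where
  "psi2_norm M Y =
     Inf (ennreal ` {r. r > 0 \<and> (\<integral>\<^sup>+ \<omega>. ennreal (exp ((Y \<omega>)\<^sup>2 / r\<^sup>2)) \<partial>M) \<le> 2})"

definition subgaussian :: "'a measure \<Rightarrow> real \<Rightarrow> ('a \<Rightarrow> real) \<Rightarrow> bool" where
  "subgaussian M K Y \<longleftrightarrow> Y \<in> borel_measurable M \<and> psi2_norm M Y \<le> ennreal K"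

definition is_median :: "'a measure \<Rightarrow> ('a \<Rightarrow> real) \<Rightarrow> real \<Rightarrow> bool" where
  "is_median M Y m \<longleftrightarrow>
     measure M {\<omega> \<in> space M. Y \<omega> \<ge> m} \<ge> 1 / 2 \<and>
     measure M {\<omega> \<in> space M. Y \<omega> \<le> m} \<ge> 1 / 2"

(* R^n, for n a variable, is rendered as the functions on {..<n} that are undefined elsewhere,
   i.e. the space of the n-fold product measure PiM {..<n} (%_. borel). *)
abbreviation Rn :: "nat \<Rightarrow> (nat \<Rightarrow> real) set" where
  "Rn n \<equiv> (\<Pi>\<^sub>E i\<in>{..<n}. UNIV)"

definition convex_fun_Rn :: "nat \<Rightarrow> ((nat \<Rightarrow> real) \<Rightarrow> real) \<Rightarrow> bool" where
  "convex_fun_Rn n f \<longleftrightarrow>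
     (\<forall>x\<in>Rn n. \<forall>y\<in>Rn n. \<forall>u\<in>{0..1}.
        f (\<lambda>i\<in>{..<n}. (1 - u) * x i + u * y i) \<le> (1 - u) * f x + u * f y)"

(* Not lipschitz_on: the library's metric on nat => real is not the Euclidean one. *)
definition lipschitz_Rn :: "nat \<Rightarrow> real \<Rightarrow> ((nat \<Rightarrow> real) \<Rightarrow> real) \<Rightarrow> bool" where
  "lipschitz_Rn n L f \<longleftrightarrow>
     (\<forall>x\<in>Rn n. \<forall>y\<in>Rn n. \<bar>f x - f y\<bar> \<le> L * L2_set (\<lambda>i. x i - y i) {..<n})"

definition random_vector :: "nat \<Rightarrow> (nat \<Rightarrow> 'a \<Rightarrow> real) \<Rightarrow> 'a \<Rightarrow> nat \<Rightarrow> real" where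
  "random_vector n X \<omega> = (\<lambda>i\<in>{..<n}. X i \<omega>)"

end

theory Submission
  imports Defs
begin

text \<open>
  All examples have independent coordinates \<open>X\<^sub>i = a B\<^sub>i\<close> with Bernoulli bits \<open>B\<^sub>i\<close> of success
  probability \<open>q\<close>; such a coordinate is \<open>K\<close>-subgaussian as soon as
  \<open>q (exp (a\<^sup>2 / K\<^sup>2) - 1) \<le> 1\<close>. Put \<open>y = t\<^sup>2 / K\<^sup>2\<close>. The rate to be reached is of order
  \<open>y / ln (2 + n / y)\<close>.

  The logarithm is gained from sparse vectors. Let \<open>f\<close> be the Euclidean norm, so that
  \<open>f(X) = a sqrt N\<close> with \<open>N\<close> binomial of mean \<open>l = n q\<close>. Sparsity allows a large jump height
  \<open>a = K sqrt (ln (n / l))\<close>. The median of \<open>N\<close> lies between \<open>l / 2\<close> and \<open>2 l\<close>. The event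
  \<open>N = 0\<close> brings \<open>f(X)\<close> down to \<open>0\<close>, and the event \<open>N \<ge> 9 l / 2\<close> brings it up to
  \<open>a sqrt (2 l) + a sqrt (l / 2)\<close>; both change \<open>f(X)\<close> by at least \<open>a sqrt (l / 2)\<close> from its
  median, and each costs only a probability \<open>exp (- O(l))\<close>. It remains to take \<open>l\<close> as small as
  \<open>t \<le> a sqrt (l / 2)\<close> permits. This condition reads \<open>y \<le> (l / 2) ln (n / l)\<close>, and it holds for
  \<open>l\<close> of order \<open>1 + y / ln (2 + n / y)\<close>; the summand \<open>1\<close> only costs a constant factor
  (lemmas \<open>norm_scaled_bits_tails\<close> and \<open>rate_parameter\<close>).

  This choice needs \<open>l\<close> to be much smaller than \<open>n\<close>, hence \<open>y\<close> much smaller than \<open>n\<close>. When \<open>n / y\<close> is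
  bounded, the logarithm is bounded as well and a one-dimensional example with tails
  \<open>exp (- O(y))\<close> suffices. When \<open>y \<le> 1\<close>, the same example already deviates with probability
  bounded below. It is half the difference of two coordinates of height \<open>2 t\<close>, a symmetric
  variable with values \<open>t\<close>, \<open>0\<close>, \<open>- t\<close> and median \<open>0\<close>
  (lemmas \<open>half_difference_scaled_bits_tails\<close> and \<open>extreme_deviation_rate\<close>).
\<close>

section \<open>Vectors of independent scaled bits\<close>

definition iid_bits :: "nat \<Rightarrow> real \<Rightarrow> (nat \<Rightarrow> bool) pmf" where
  "iid_bits n q = Pi_pmf {..<n} False (\<lambda>_. bernoulli_pmf q)"

definition scaled_bits :: "real \<Rightarrow> nat \<Rightarrow> real \<Rightarrow> (nat \<Rightarrow> real) pmf" where
  "scaled_bits a n q = map_pmf (\<lambda>b i. a * of_bool (b i)) (iid_bits n q)"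

abbreviation (input) coord :: "nat \<Rightarrow> (nat \<Rightarrow> real) \<Rightarrow> real" where
  "coord i \<omega> \<equiv> \<omega> i"

text \<open>
  The law is built from the bits so that events become statements about them. Independence and
  the marginal laws are read off from the following product form.
\<close>

lemma scaled_bits_eq_Pi_pmf:
  "scaled_bits a n q =
     Pi_pmf {..<n} 0 (\<lambda>_. map_pmf (\<lambda>b. a * of_bool b) (bernoulli_pmf q))"
  unfolding scaled_bits_def iid_bits_def
  by (subst Pi_pmf_map[where dflt = False]) (auto intro!: map_pmf_cong)

lemma indep_vars_scaled_bits:
  "prob_space.indep_vars (scaled_bits a n q) (\<lambda>_. borel) coord {..<n}"
proof -
  have "prob_space.indep_vars (scaled_bits a n q) (\<lambda>_. count_space UNIV) coord {..<n}"
    unfolding scaled_bits_eq_Pi_pmf by (rule indep_vars_Pi_pmf) simp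
  from prob_space.indep_vars_compose2[OF prob_space_measure_pmf this, of "\<lambda>_ x. x" "\<lambda>_. borel"]
  show ?thesis by simp
qed

lemma subgaussian_scaled_bits:
  assumes "K > 0" "0 \<le> q" "q \<le> 1" "q * (exp (a\<^sup>2 / K\<^sup>2) - 1) \<le> 1" "i < n"
  shows "subgaussian (scaled_bits a n q) K (coord i)"
proof -
  have "(\<integral>\<^sup>+ \<omega>. ennreal (exp ((coord i \<omega>)\<^sup>2 / K\<^sup>2)) \<partial>scaled_bits a n q)
      = (\<integral>\<^sup>+ x. ennreal (exp (x\<^sup>2 / K\<^sup>2)) \<partial>map_pmf (coord i) (scaled_bits a n q))"
    by simp
  also have "map_pmf (coord i) (scaled_bits a n q) = map_pmf (\<lambda>b. a * of_bool b) (bernoulli_pmf q)"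
    unfolding scaled_bits_eq_Pi_pmf using \<open>i < n\<close> by (subst Pi_pmf_component) auto
  also have "(\<integral>\<^sup>+ x. ennreal (exp (x\<^sup>2 / K\<^sup>2)) \<partial>\<dots>)
      = ennreal (exp (a\<^sup>2 / K\<^sup>2)) * q + ennreal (1 - q)"
    using assms by (simp add: mult.commute)
  also have "\<dots> = ennreal (exp (a\<^sup>2 / K\<^sup>2) * q + (1 - q))"
    using assms by (simp add: ennreal_mult ennreal_plus)
  also have "\<dots> \<le> ennreal 2"
    using assms by (intro ennreal_leI) (simp add: algebra_simps)
  finally have "(\<integral>\<^sup>+ \<omega>. ennreal (exp ((coord i \<omega>)\<^sup>2 / K\<^sup>2)) \<partial>scaled_bits a n q) \<le> 2"
    by simp
  then have "psi2_norm (scaled_bits a n q) (coord i) \<le> ennreal K"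
    unfolding psi2_norm_def using \<open>K > 0\<close> by (intro Inf_lower) auto
  then show ?thesis
    by (simp add: subgaussian_def)
qed

text \<open>
  The next three lemmas carry an event from the real vector to the bits, where the law of the
  number of ones is known.
\<close>

lemma measure_scaled_bits:
  "measure (scaled_bits a n q) {\<omega> \<in> space (scaled_bits a n q). Q (random_vector n coord \<omega>)}
     = measure (iid_bits n q) {b. Q (\<lambda>i\<in>{..<n}. a * of_bool (b i))}"
  by (simp add: scaled_bits_def random_vector_def vimage_def)

lemma measure_scaled_bits_mono:
  assumes "\<And>b. Q (\<lambda>i\<in>{..<n}. a * of_bool (b i)) \<Longrightarrow> R b"
  shows "measure (scaled_bits a n q) {\<omega> \<in> space (scaled_bits a n q). Q (random_vector n coord \<omega>)}
     \<le> measure (iid_bits n q) {b. R b}"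
  unfolding measure_scaled_bits using assms
  by (intro measure_pmf.finite_measure_mono) auto

lemma measure_scaled_bits_ge:
  assumes "\<And>b. R b \<Longrightarrow> Q (\<lambda>i\<in>{..<n}. a * of_bool (b i))"
  shows "measure (iid_bits n q) {b. R b} \<le>
    measure (scaled_bits a n q) {\<omega> \<in> space (scaled_bits a n q). Q (random_vector n coord \<omega>)}"
  unfolding measure_scaled_bits using assms
  by (intro measure_pmf.finite_measure_mono) auto

section \<open>Two tails of the binomial law\<close>

definition ones :: "nat \<Rightarrow> (nat \<Rightarrow> bool) \<Rightarrow> nat" where
  "ones n b = card {i \<in> {..<n}. b i}"

lemma map_ones_iid_bits:
  "0 \<le> q \<Longrightarrow> q \<le> 1 \<Longrightarrow> map_pmf (ones n) (iid_bits n q) = binomial_pmf n q"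
  unfolding iid_bits_def ones_def by (subst binomial_pmf_altdef'[where A = "{..<n}"]) auto

lemma measure_ones:
  assumes "0 \<le> q" "q \<le> 1"
  shows "measure (iid_bits n q) {b. Q (ones n b)} = measure (binomial_pmf n q) {k. Q k}"
  unfolding map_ones_iid_bits[OF assms, symmetric] by (simp add: vimage_def)

lemma binomial_generating_function:
  assumes "0 \<le> q" "q \<le> 1"
  shows "measure_pmf.expectation (binomial_pmf n q) (\<lambda>k. s ^ k) = (1 - q + q * s) ^ n"
proof -
  have "measure_pmf.expectation (binomial_pmf n q) (\<lambda>k. s ^ k)
      = (\<Sum>k\<le>n. of_nat (n choose k) * (q * s) ^ k * (1 - q) ^ (n - k))"
    using assms by (simp add: expectation_binomial_pmf' power_mult_distrib mult_ac)
  also have "\<dots> = (q * s + (1 - q)) ^ n"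
    by (rule binomial_ring[symmetric])
  finally show ?thesis by (simp add: add_ac)
qed

text \<open>
  The exponential Markov inequality, combined with \<open>1 + x \<le> exp x\<close>. The event is kept in the
  form \<open>s ^ k \<ge> s powr x\<close> so that \<open>s = 2\<close> yields an upper tail and \<open>s = 1 / 2\<close> a lower tail.
\<close>

lemma binomial_chernoff:
  assumes "0 \<le> q" "q \<le> 1" "s > 0"
  shows "measure (binomial_pmf n q) {k. s ^ k \<ge> s powr x} \<le> exp (real n * q * (s - 1)) / s powr x"
proof -
  have q: "q \<in> {0..1}" using assms by simp
  have "measure (binomial_pmf n q) {k \<in> UNIV. s ^ k \<ge> s powr x}
      \<le> measure_pmf.expectation (binomial_pmf n q) (\<lambda>k. s ^ k) / s powr x"
    using integral_Markov_inequality_measure[of "binomial_pmf n q" "\<lambda>k. s ^ k" "UNIV" "s powr x"]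
      assms integrable_binomial_pmf[OF q] by simp
  also have "\<dots> = (1 - q + q * s) ^ n / s powr x"
    using assms by (simp add: binomial_generating_function)
  also have "(1 - q + q * s) ^ n \<le> exp (q * (s - 1)) ^ n"
  proof (rule power_mono)
    show "1 - q + q * s \<le> exp (q * (s - 1))"
      using exp_ge_add_one_self[of "q * (s - 1)"] by (simp add: algebra_simps)
    show "0 \<le> 1 - q + q * s"
      using assms by (intro add_nonneg_nonneg mult_nonneg_nonneg) auto
  qed
  also have "\<dots> = exp (real n * q * (s - 1))"
    by (simp add: exp_of_nat_mult[symmetric] mult_ac)
  finally show ?thesis using assms by (simp add: divide_right_mono)
qed

text \<open>
  This lemma and the next one confine every median of the binomial law between half its mean
  and twice its mean. The exponents \<open>2 ln 2 - 1\<close> and \<open>(1 - ln 2) / 2\<close> left over by the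
  exponential Markov inequality are positive; a mean of \<open>9\<close> makes both bounds less than one half.
\<close>

lemma binomial_upper_tail_lt_half:
  assumes "0 \<le> q" "q \<le> 1" "real n * q \<ge> 9"
  shows "measure (binomial_pmf n q) {k. real k \<ge> 2 * (real n * q)} < 1 / 2"
proof -
  define l where "l = real n * q"
  have "measure (binomial_pmf n q) {k. real k \<ge> 2 * l}
      \<le> measure (binomial_pmf n q) {k. (2::real) ^ k \<ge> 2 powr (2 * l)}"
    by (intro measure_pmf.finite_measure_mono) (auto simp: powr_realpow[symmetric])
  also have "\<dots> \<le> exp l / 2 powr (2 * l)"
    using binomial_chernoff[of q 2 n "2 * l"] assms by (simp add: l_def)
  also have "\<dots> = exp (l - 2 * l * ln 2)"
    by (simp add: powr_def exp_diff)
  also have "\<dots> = exp (- (l * (2 * ln 2 - 1)))"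
    by (simp add: algebra_simps)
  also have "\<dots> \<le> exp (- (9 * (1 / 3)))"
    using assms ln2_ge_two_thirds
    by (subst exp_le_cancel_iff, subst neg_le_iff_le, intro mult_mono) (auto simp: l_def)
  also have "\<dots> < 1 / 2"
    using exp_ge_add_one_self[of "3 :: real"] by (simp add: exp_minus field_simps)
  finally show ?thesis by (simp add: l_def)
qed

lemma binomial_lower_tail_lt_half:
  assumes "0 \<le> q" "q \<le> 1" "real n * q \<ge> 9"
  shows "measure (binomial_pmf n q) {k. real k \<le> real n * q / 2} < 1 / 2"
proof -
  define l where "l = real n * q"
  have "measure (binomial_pmf n q) {k. real k \<le> l / 2}
      \<le> measure (binomial_pmf n q) {k. (1 / 2 :: real) ^ k \<ge> (1 / 2) powr (l / 2)}"
    by (intro measure_pmf.finite_measure_mono) (auto simp: powr_realpow[symmetric] intro!: powr_mono')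
  also have "\<dots> \<le> exp (- l / 2) / (1 / 2) powr (l / 2)"
    using binomial_chernoff[of q "1 / 2" n "l / 2"] assms by (simp add: l_def)
  also have "\<dots> = exp (- (l * ((1 - ln 2) / 2)))"
    by (simp add: powr_def exp_diff[symmetric] ln_div algebra_simps diff_divide_distrib)
  also have "\<dots> \<le> exp (- (9 * (11 / 72)))"
    using assms ln2_le_25_over_36
    by (subst exp_le_cancel_iff, subst neg_le_iff_le, intro mult_mono) (auto simp: l_def)
  also have "\<dots> < 1 / 2"
    using exp_ge_add_one_self[of "11 / 8 :: real"] by (simp add: exp_minus field_simps)
  finally show ?thesis by (simp add: l_def)
qed

text \<open>
  The converse of \<open>1 - q \<le> exp (- q)\<close>, up to the factor \<open>2\<close> in the exponent: the concave
  function \<open>(1 + 2 q) (1 - q)\<close> equals \<open>1\<close> at both ends of the interval from \<open>0\<close> to \<open>1 / 2\<close>.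
\<close>

lemma one_minus_power_ge_exp:
  fixes q :: real
  assumes "0 \<le> q" "q \<le> 1 / 2" "j \<le> n"
  shows "(1 - q) ^ j \<ge> exp (- (2 * (real n * q)))"
proof -
  have "exp (2 * q) * (1 - q) \<ge> (1 + 2 * q) * (1 - q)"
    using assms by (intro mult_right_mono) auto
  also have "(1 + 2 * q) * (1 - q) = 1 + q * (1 - 2 * q)"
    by (simp add: algebra_simps)
  also have "\<dots> \<ge> 1" using assms by simp
  finally have "exp (- (2 * q)) \<le> 1 - q"
    by (simp add: exp_minus field_simps)
  then have "exp (- (2 * q)) ^ n \<le> (1 - q) ^ n"
    by (intro power_mono) auto
  also have "\<dots> \<le> (1 - q) ^ j"
    using assms by (intro power_decreasing) auto
  finally show ?thesis
    by (simp add: exp_of_nat_mult[symmetric] mult_ac)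
qed

lemma pmf_binomial_0_ge:
  assumes "0 \<le> q" "q \<le> 1 / 2"
  shows "pmf (binomial_pmf n q) 0 \<ge> exp (- (2 * (real n * q)))"
  using one_minus_power_ge_exp[of q n n] assms by simp

text \<open>
  A single atom suffices. For \<open>k\<close> between \<open>9 l / 2\<close> and \<open>5 l\<close>, with \<open>l = n q\<close>, the bound
  \<open>(n / k) ^ k\<close> for the binomial coefficient turns \<open>(n choose k) q ^ k\<close> into
  \<open>(l / k) ^ k \<ge> 5 powr (- 5 l)\<close>, and the remaining bits vanish with probability at least
  \<open>exp (- 2 l)\<close>.
\<close>

lemma binomial_large_deviation_ge:
  assumes "0 \<le> q" "real n * q \<ge> 9" "q \<le> 1 / 10"
  shows "measure (binomial_pmf n q) {k. real k \<ge> 9 / 2 * (real n * q)}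
           \<ge> exp (- (12 * (real n * q)))"
proof -
  define l where "l = real n * q"
  define k where "k = nat \<lceil>9 / 2 * l\<rceil>"
  have l: "l \<ge> 9" using assms by (simp add: l_def)
  have k: "real k \<ge> 9 / 2 * l" "real k \<le> 5 * l"
    using l unfolding k_def by linarith+
  have "k \<le> n"
  proof -
    have "5 * l \<le> 5 * (real n * (1 / 10))"
      unfolding l_def using assms by (intro mult_left_mono) auto
    then show ?thesis using k by simp
  qed
  have kpos: "real k > 0" using k l by linarith
  have five: "exp (- 2 :: real) \<le> 1 / 5"
  proof -
    have "(5 :: real) \<le> exp 2"
      using exp_lower_Taylor_quadratic[of "2 :: real"] by simp
    then show ?thesis by (simp add: exp_minus field_simps)
  qed
  have "exp (- (2 * (5 * l))) \<le> exp (- (2 * real k))"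
    using k by simp
  also have "\<dots> = exp (- 2) ^ k"
    by (simp add: exp_of_nat_mult[symmetric] mult_ac)
  also have "\<dots> \<le> (l / real k) ^ k"
  proof (rule power_mono)
    have "1 / 5 \<le> l / real k"
      using k kpos by (simp add: field_simps)
    with five show "exp (- 2) \<le> l / real k" by linarith
  qed simp
  also have "\<dots> = (real n / real k) ^ k * q ^ k"
    by (simp add: l_def power_mult_distrib[symmetric])
  also have "\<dots> \<le> real (n choose k) * q ^ k"
    using binomial_ge_n_over_k_pow_k[OF \<open>k \<le> n\<close>, where 'a = real] assms
    by (intro mult_right_mono) auto
  finally have choose: "exp (- (2 * (5 * l))) \<le> real (n choose k) * q ^ k" .
  have "exp (- (12 * l)) = exp (- (2 * (5 * l))) * exp (- (2 * l))"
    by (simp add: exp_add[symmetric])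
  also have "\<dots> \<le> (real (n choose k) * q ^ k) * (1 - q) ^ (n - k)"
    using choose one_minus_power_ge_exp[of q "n - k" n] assms
    by (intro mult_mono) (auto simp: l_def)
  also have "\<dots> = pmf (binomial_pmf n q) k"
    using assms by simp
  also have "\<dots> = measure (binomial_pmf n q) {k}"
    by (simp add: measure_pmf_single)
  also have "\<dots> \<le> measure (binomial_pmf n q) {k. real k \<ge> 9 / 2 * l}"
    using k by (intro measure_pmf.finite_measure_mono) auto
  finally show ?thesis by (simp add: l_def)
qed


section \<open>Typical deviations: the Euclidean norm\<close>

lemma convex_fun_Rn_L2_set: "convex_fun_Rn n (\<lambda>x. L2_set x {..<n})"
  unfolding convex_fun_Rn_def
proof (intro ballI)
  fix x y :: "nat \<Rightarrow> real" and u :: real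
  assume u: "u \<in> {0..1}"
  have "L2_set (\<lambda>i\<in>{..<n}. (1 - u) * x i + u * y i) {..<n}
      = L2_set (\<lambda>i. (1 - u) * x i + u * y i) {..<n}"
    by (rule L2_set_cong) auto
  also have "\<dots> \<le> L2_set (\<lambda>i. (1 - u) * x i) {..<n} + L2_set (\<lambda>i. u * y i) {..<n}"
    by (rule L2_set_triangle_ineq)
  also have "\<dots> = (1 - u) * L2_set x {..<n} + u * L2_set y {..<n}"
    using u by (simp add: L2_set_right_distrib)
  finally show "L2_set (\<lambda>i\<in>{..<n}. (1 - u) * x i + u * y i) {..<n}
      \<le> (1 - u) * L2_set x {..<n} + u * L2_set y {..<n}" .
qed

lemma lipschitz_Rn_L2_set: "lipschitz_Rn n 1 (\<lambda>x. L2_set x {..<n})"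
  unfolding lipschitz_Rn_def
proof (intro ballI)
  fix x y :: "nat \<Rightarrow> real"
  have "L2_set x {..<n} \<le> L2_set (\<lambda>i. x i - y i) {..<n} + L2_set y {..<n}"
    using L2_set_triangle_ineq[of "\<lambda>i. x i - y i" y "{..<n}"] by simp
  moreover have "L2_set y {..<n} \<le> L2_set (\<lambda>i. y i - x i) {..<n} + L2_set x {..<n}"
    using L2_set_triangle_ineq[of "\<lambda>i. y i - x i" x "{..<n}"] by simp
  moreover have "L2_set (\<lambda>i. y i - x i) {..<n} = L2_set (\<lambda>i. x i - y i) {..<n}"
    by (simp add: L2_set_def power2_commute)
  ultimately show "\<bar>L2_set x {..<n} - L2_set y {..<n}\<bar> \<le> 1 * L2_set (\<lambda>i. x i - y i) {..<n}"
    by linarith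
qed

lemma L2_set_scaled_bits:
  assumes "a \<ge> 0"
  shows "L2_set (\<lambda>i\<in>{..<n}. a * of_bool (b i)) {..<n} = a * sqrt (ones n b)"
proof -
  have "L2_set (\<lambda>i\<in>{..<n}. a * of_bool (b i)) {..<n} = L2_set (\<lambda>i. a * of_bool (b i)) {..<n}"
    by (rule L2_set_cong) auto
  also have "\<dots> = a * L2_set (\<lambda>i. of_bool (b i)) {..<n}"
    using assms by (simp add: L2_set_right_distrib)
  also have "L2_set (\<lambda>i. of_bool (b i)) {..<n} = sqrt (ones n b)"
    unfolding L2_set_def ones_def
    by (simp add: of_bool_def if_distrib[of "\<lambda>x. x ^ 2"] sum.If_cases Int_def cong: if_cong)
  finally show ?thesis .
qed

text \<open>
  On the bits the norm is \<open>a sqrt N\<close>, and its median \<open>m\<close> satisfies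
  \<open>a sqrt (l / 2) < m < a sqrt (2 l)\<close>. For the lower tail take \<open>N = 0\<close>. The threshold \<open>9 l / 2\<close>
  for the upper tail comes from the identity \<open>sqrt (2 l) + sqrt (l / 2) = sqrt (9 l / 2)\<close>.
\<close>

lemma norm_scaled_bits_tails:
  assumes q: "0 \<le> q" "q \<le> 1 / 10" and l: "l = real n * q" "l \<ge> 9"
    and a: "a > 0" and t: "t > 0" "t \<le> a * sqrt (l / 2)"
    and m: "is_median (scaled_bits a n q) (\<lambda>\<omega>. L2_set (random_vector n coord \<omega>) {..<n}) m"
  shows "measure (scaled_bits a n q)
      {\<omega> \<in> space (scaled_bits a n q). L2_set (random_vector n coord \<omega>) {..<n} - m \<ge> t}
        \<ge> exp (- (12 * l))" (is ?upper)
    and "measure (scaled_bits a n q)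
      {\<omega> \<in> space (scaled_bits a n q). L2_set (random_vector n coord \<omega>) {..<n} - m \<le> - t}
        \<ge> exp (- (12 * l))" (is ?lower)
proof -
  have q1: "q \<le> 1" using q by simp
  have m_gt: "a * sqrt (l / 2) < m"
  proof (rule ccontr)
    assume "\<not> a * sqrt (l / 2) < m"
    then have m_le: "m \<le> a * sqrt (l / 2)" by simp
    have "1 / 2 \<le> measure (scaled_bits a n q)
      {\<omega> \<in> space (scaled_bits a n q). L2_set (random_vector n coord \<omega>) {..<n} \<le> m}"
      using m by (simp only: is_median_def)
    also have "\<dots> \<le> measure (iid_bits n q) {b. real (ones n b) \<le> l / 2}"
    proof (rule measure_scaled_bits_mono)
      fix b assume "L2_set (\<lambda>i\<in>{..<n}. a * of_bool (b i)) {..<n} \<le> m"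
      then have "a * sqrt (ones n b) \<le> m"
        using a by (simp add: L2_set_scaled_bits)
      also note m_le
      finally have "sqrt (ones n b) \<le> sqrt (l / 2)"
        using a by (simp only: mult_le_cancel_left_pos)
      then show "real (ones n b) \<le> l / 2" by (simp only: real_sqrt_le_iff)
    qed
    also have "\<dots> < 1 / 2"
      unfolding measure_ones[OF q(1) q1, where Q = "\<lambda>k. real k \<le> l / 2"]
      using binomial_lower_tail_lt_half[of q n] q q1 l by simp
    finally show False by simp
  qed
  have m_lt: "m < a * sqrt (2 * l)"
  proof (rule ccontr)
    assume "\<not> m < a * sqrt (2 * l)"
    then have m_ge: "a * sqrt (2 * l) \<le> m" by simp
    have "1 / 2 \<le> measure (scaled_bits a n q)
      {\<omega> \<in> space (scaled_bits a n q). L2_set (random_vector n coord \<omega>) {..<n} \<ge> m}"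
      using m by (simp only: is_median_def)
    also have "\<dots> \<le> measure (iid_bits n q) {b. real (ones n b) \<ge> 2 * l}"
    proof (rule measure_scaled_bits_mono)
      fix b assume "m \<le> L2_set (\<lambda>i\<in>{..<n}. a * of_bool (b i)) {..<n}"
      then have "m \<le> a * sqrt (ones n b)"
        using a by (simp add: L2_set_scaled_bits)
      with m_ge have "a * sqrt (2 * l) \<le> a * sqrt (ones n b)" by (rule order.trans)
      then have "sqrt (2 * l) \<le> sqrt (ones n b)"
        using a by (simp only: mult_le_cancel_left_pos)
      then show "2 * l \<le> real (ones n b)" by (simp only: real_sqrt_le_iff)
    qed
    also have "\<dots> < 1 / 2"
      unfolding measure_ones[OF q(1) q1, where Q = "\<lambda>k. real k \<ge> 2 * l"]
      using binomial_upper_tail_lt_half[of q n] q q1 l by simp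
    finally show False by simp
  qed
  have "exp (- (12 * l)) \<le> measure (binomial_pmf n q) {k. real k \<ge> 9 / 2 * l}"
    using binomial_large_deviation_ge[of q n] q l by simp
  also have "\<dots> = measure (iid_bits n q) {b. real (ones n b) \<ge> 9 / 2 * l}"
    unfolding measure_ones[OF q(1) q1, where Q = "\<lambda>k. real k \<ge> 9 / 2 * l"] ..
  also have "\<dots> \<le> measure (scaled_bits a n q)
      {\<omega> \<in> space (scaled_bits a n q). L2_set (random_vector n coord \<omega>) {..<n} - m \<ge> t}"
  proof (rule measure_scaled_bits_ge)
    fix b assume b: "9 / 2 * l \<le> real (ones n b)"
    have "sqrt (9 / 2 * l) = sqrt (3\<^sup>2 * (l / 2))" "sqrt (2 * l) = sqrt (2\<^sup>2 * (l / 2))"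
      by simp_all
    then have "sqrt (9 / 2 * l) = sqrt (2 * l) + sqrt (l / 2)"
      unfolding real_sqrt_mult by simp
    then have "a * sqrt (2 * l) + a * sqrt (l / 2) = a * sqrt (9 / 2 * l)"
      by (simp only: distrib_left)
    also have "\<dots> \<le> a * sqrt (ones n b)"
      using a b by (intro mult_left_mono) auto
    finally show "t \<le> L2_set (\<lambda>i\<in>{..<n}. a * of_bool (b i)) {..<n} - m"
      using a m_lt t by (simp add: L2_set_scaled_bits)
  qed
  finally show ?upper .
  have "exp (- (12 * l)) \<le> exp (- (2 * (real n * q)))"
    unfolding l(1)[symmetric] using l(2) by simp
  also have "\<dots> \<le> pmf (binomial_pmf n q) 0"
    using q by (intro pmf_binomial_0_ge) auto
  also have "\<dots> = measure (iid_bits n q) {b. ones n b = 0}"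
    using q q1 by (simp only: measure_ones[where Q = "\<lambda>k. k = 0"]) (simp add: measure_pmf_single)
  also have "\<dots> \<le> measure (scaled_bits a n q)
      {\<omega> \<in> space (scaled_bits a n q). L2_set (random_vector n coord \<omega>) {..<n} - m \<le> - t}"
  proof (rule measure_scaled_bits_ge)
    fix b assume "ones n b = 0"
    then show "L2_set (\<lambda>i\<in>{..<n}. a * of_bool (b i)) {..<n} - m \<le> - t"
      using a m_gt t by (simp add: L2_set_scaled_bits)
  qed
  finally show ?lower .
qed

section \<open>Extreme deviations: a difference of two coordinates\<close>

definition half_difference :: "(nat \<Rightarrow> real) \<Rightarrow> real" where
  "half_difference x = (x 0 - x 1) / 2"

lemma convex_fun_Rn_half_difference:
  assumes "n \<ge> 2" shows "convex_fun_Rn n half_difference"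
  using assms by (auto simp: convex_fun_Rn_def half_difference_def field_simps)

lemma lipschitz_Rn_half_difference:
  assumes "n \<ge> 2" shows "lipschitz_Rn n 1 half_difference"
  unfolding lipschitz_Rn_def
proof (intro ballI)
  fix x y :: "nat \<Rightarrow> real"
  have "\<bar>x i - y i\<bar> \<le> L2_set (\<lambda>i. x i - y i) {..<n}" if "i < n" for i
  proof -
    have "\<bar>x i - y i\<bar> \<le> L2_set (\<lambda>i. \<bar>x i - y i\<bar>) {..<n}"
      using that by (intro member_le_L2_set) auto
    then show ?thesis by (simp add: L2_set_def)
  qed
  then have "\<bar>x 0 - y 0\<bar> \<le> L2_set (\<lambda>i. x i - y i) {..<n}"
    and "\<bar>x 1 - y 1\<bar> \<le> L2_set (\<lambda>i. x i - y i) {..<n}"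
    using assms by auto
  then
  show "\<bar>half_difference x - half_difference y\<bar> \<le> 1 * L2_set (\<lambda>i. x i - y i) {..<n}"
    unfolding half_difference_def by (simp add: field_simps)
qed

lemma measure_two_bits:
  assumes "i < n" "j < n" "i \<noteq> j" "0 \<le> q" "q \<le> 1"
  shows "measure (iid_bits n q) {b. b i \<and> \<not> b j} = q * (1 - q)"
proof -
  have "{b. b i \<and> \<not> b j} = Pi {..<n} (\<lambda>k. if k = i then {True} else if k = j then {False} else UNIV)"
    using assms by (auto simp: Pi_def split: if_splits)
  then have "measure (iid_bits n q) {b. b i \<and> \<not> b j}
      = (\<Prod>k<n. measure (bernoulli_pmf q)
           (if k = i then {True} else if k = j then {False} else UNIV))"
    unfolding iid_bits_def by (simp add: measure_Pi_pmf_Pi)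
  also have "\<dots> = (\<Prod>k\<in>{i, j}. measure (bernoulli_pmf q)
           (if k = i then {True} else if k = j then {False} else UNIV))"
    using assms by (intro prod.mono_neutral_right) auto
  also have "\<dots> = q * (1 - q)"
    using assms by (simp add: measure_pmf_single)
  finally show ?thesis .
qed

lemma measure_one_bit:
  assumes "i < n" "0 \<le> q" "q \<le> 1"
  shows "measure (iid_bits n q) {b. b i} = q"
proof -
  have "measure (iid_bits n q) {b. b i} = measure (map_pmf (\<lambda>b. b i) (iid_bits n q)) {True}"
    by (simp add: vimage_def)
  also have "\<dots> = q"
    unfolding iid_bits_def using assms by (subst Pi_pmf_component) (auto simp: measure_pmf_single)
  finally show ?thesis .
qed

text \<open>
  Each of the values \<open>t\<close> and \<open>- t\<close> requires one particular bit to be set, which has probability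
  \<open>q < 1 / 2\<close>. So the median is \<open>0\<close>, and each tail contains the event that exactly the right one
  of the two bits is set.
\<close>

lemma half_difference_scaled_bits_tails:
  assumes n: "n \<ge> 2" and q: "0 \<le> q" "q \<le> 1 / 8" and t: "t > 0"
    and m: "is_median (scaled_bits (2 * t) n q) (\<lambda>\<omega>. half_difference (random_vector n coord \<omega>)) m"
  shows "measure (scaled_bits (2 * t) n q) {\<omega> \<in> space (scaled_bits (2 * t) n q).
            half_difference (random_vector n coord \<omega>) - m \<ge> t} \<ge> q * (1 - q)" (is ?upper)
    and "measure (scaled_bits (2 * t) n q) {\<omega> \<in> space (scaled_bits (2 * t) n q).
            half_difference (random_vector n coord \<omega>) - m \<le> - t} \<ge> q * (1 - q)" (is ?lower)
proof -
  have hd: "half_difference (\<lambda>i\<in>{..<n}. 2 * t * of_bool (b i)) = t * (of_bool (b 0) - of_bool (b 1))"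
    for b :: "nat \<Rightarrow> bool"
    using n by (simp add: half_difference_def field_simps)
  have m_le: "m \<le> 0"
  proof (rule ccontr)
    assume "\<not> m \<le> 0"
    have "1 / 2 \<le> measure (scaled_bits (2 * t) n q) {\<omega> \<in> space (scaled_bits (2 * t) n q).
            half_difference (random_vector n coord \<omega>) \<ge> m}"
      using m by (simp only: is_median_def)
    also have "\<dots> \<le> measure (iid_bits n q) {b. b 0}"
    proof (rule measure_scaled_bits_mono)
      fix b assume "m \<le> half_difference (\<lambda>i\<in>{..<n}. 2 * t * of_bool (b i))"
      then show "b 0"
        unfolding hd using \<open>\<not> m \<le> 0\<close> t by (cases "b 0"; cases "b 1") auto
    qed
    also have "\<dots> = q" using n q by (intro measure_one_bit) auto
    finally show False using q by simp
  qed
  have m_ge: "m \<ge> 0"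
  proof (rule ccontr)
    assume "\<not> m \<ge> 0"
    have "1 / 2 \<le> measure (scaled_bits (2 * t) n q) {\<omega> \<in> space (scaled_bits (2 * t) n q).
            half_difference (random_vector n coord \<omega>) \<le> m}"
      using m by (simp only: is_median_def)
    also have "\<dots> \<le> measure (iid_bits n q) {b. b 1}"
    proof (rule measure_scaled_bits_mono)
      fix b assume "half_difference (\<lambda>i\<in>{..<n}. 2 * t * of_bool (b i)) \<le> m"
      then show "b 1"
        unfolding hd using \<open>\<not> m \<ge> 0\<close> t by (cases "b 0"; cases "b 1") auto
    qed
    also have "\<dots> = q" using n q by (intro measure_one_bit) auto
    finally show False using q by simp
  qed
  have "m = 0" using m_le m_ge by simp
  have "q * (1 - q) = measure (iid_bits n q) {b. b 0 \<and> \<not> b 1}"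
    using n q by (simp add: measure_two_bits)
  also have "\<dots> \<le> measure (scaled_bits (2 * t) n q) {\<omega> \<in> space (scaled_bits (2 * t) n q).
            half_difference (random_vector n coord \<omega>) - m \<ge> t}"
  proof (rule measure_scaled_bits_ge)
    fix b :: "nat \<Rightarrow> bool" assume "b 0 \<and> \<not> b 1"
    then show "t \<le> half_difference (\<lambda>i\<in>{..<n}. 2 * t * of_bool (b i)) - m"
      unfolding hd \<open>m = 0\<close> by simp
  qed
  finally show ?upper .
  have "q * (1 - q) = measure (iid_bits n q) {b. b 1 \<and> \<not> b 0}"
    using n q by (simp add: measure_two_bits)
  also have "\<dots> \<le> measure (scaled_bits (2 * t) n q) {\<omega> \<in> space (scaled_bits (2 * t) n q).
            half_difference (random_vector n coord \<omega>) - m \<le> - t}"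
  proof (rule measure_scaled_bits_ge)
    fix b :: "nat \<Rightarrow> bool" assume "b 1 \<and> \<not> b 0"
    then show "half_difference (\<lambda>i\<in>{..<n}. 2 * t * of_bool (b i)) - m \<le> - t"
      unfolding hd \<open>m = 0\<close> by simp
  qed
  finally show ?lower .
qed

section \<open>Choice of the parameters\<close>

text \<open>
  Here \<open>r\<close> stands for \<open>n / y\<close>, so \<open>r y = n\<close>. The second conclusion is the condition
  \<open>y \<le> (l / 2) ln (n / l)\<close>; the first keeps \<open>q = l / n\<close> at most \<open>1 / 10\<close>. Since the logarithm is
  at least \<open>1\<close> and \<open>y \<ge> 1\<close>, one has \<open>l \<le> 13 y\<close>, so \<open>n / l \<ge> r / 13\<close>. This is at least
  \<open>sqrt (2 + r)\<close> because \<open>r \<ge> 13\<^sup>2 + 2\<close>, and therefore \<open>ln (n / l) \<ge> ln (2 + r) / 2\<close>. The term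
  \<open>4 y / ln (2 + r)\<close> in \<open>l\<close> is chosen to match exactly this bound.
\<close>

lemma rate_parameter:
  fixes r y :: real
  assumes y: "y \<ge> 1" and r: "r \<ge> 171"
  defines "l \<equiv> 9 + 4 * y / ln (2 + r)"
  shows "10 * l \<le> r * y" and "2 * y / l \<le> ln (r * y / l)"
proof -
  have "exp 1 \<le> (2 + r :: real)" using exp_le r by linarith
  then have L1: "ln (2 + r) \<ge> 1" using r by (subst ln_ge_iff) auto
  have l_pos: "l \<ge> 9" unfolding l_def using y L1 by simp
  have "4 * y / ln (2 + r) \<le> 4 * y / 1"
    using y L1 by (intro divide_left_mono) auto
  then have l_le: "l \<le> 13 * y" unfolding l_def using y by simp
  have "sqrt (2 + r) \<le> r / 13"
  proof (rule real_le_lsqrt)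
    have "171 * r \<le> r * r" using r by (intro mult_right_mono) auto
    moreover have "(r / 13)\<^sup>2 = r * r / 169" by (simp add: power2_eq_square)
    ultimately show "2 + r \<le> (r / 13)\<^sup>2" using r by linarith
  qed (use r in auto)
  also have "r / 13 \<le> r * y / l"
  proof -
    have "r * l \<le> r * (13 * y)" using l_le r by (intro mult_left_mono) auto
    then show ?thesis using l_pos by (simp add: field_simps)
  qed
  finally have sq: "sqrt (2 + r) \<le> r * y / l" .
  have "10 \<le> sqrt (2 + r)" using r by (intro real_le_rsqrt) auto
  with sq have "10 \<le> r * y / l" by linarith
  then show "10 * l \<le> r * y" using l_pos by (simp add: field_simps)
  have "4 * y / ln (2 + r) \<le> l" by (simp add: l_def)
  then have "2 * y / l \<le> ln (2 + r) / 2"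
    using L1 l_pos by (simp add: field_simps)
  also have "\<dots> = ln (sqrt (2 + r))" using r by (simp add: ln_sqrt)
  also have "\<dots> \<le> ln (r * y / l)" using sq r by (intro ln_mono) auto
  finally show "2 * y / l \<le> ln (r * y / l)" .
qed

text \<open>
  If \<open>y \<le> 1\<close>, the right-hand side is bounded below by a constant. If \<open>n \<le> 171 y\<close>, the logarithm
  is at most \<open>ln 173 \<le> 12\<close>, so that \<open>48 y\<close> divided by it is at least \<open>4 y\<close>.
\<close>

lemma extreme_deviation_rate:
  fixes n :: nat and y :: real
  assumes y: "y > 0" and small: "y \<le> 1 \<or> real n \<le> 171 * y"
  defines "q \<equiv> exp (- (4 * y)) / 8"
  shows "exp (- 108) * exp (- (48 * y / ln (2 + real n / y))) \<le> q * (1 - q)"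
proof -
  define L where "L = ln (2 + real n / y)"
  have L: "L > 0" unfolding L_def using y by (subst ln_gt_zero_iff) (auto intro: add_pos_nonneg)
  have q: "0 < q" "q \<le> 1 / 8" using y by (auto simp: q_def)
  have e4: "exp (- 4 :: real) \<ge> 16 * exp (- 108)"
  proof -
    have "exp (- 4 :: real) = exp 104 * exp (- 108)" by (simp add: exp_add[symmetric])
    moreover have "(16 :: real) \<le> exp 104" using exp_ge_add_one_self[of "104 :: real"] by simp
    ultimately show ?thesis by simp
  qed
  have "16 * exp (- 108) * exp (- (48 * y / L)) \<le> exp (- (4 * y))"
    using small
  proof
    assume "y \<le> 1"
    have "16 * exp (- 108) * exp (- (48 * y / L)) \<le> exp (- 4) * 1"
      using e4 y L by (intro mult_mono) auto
    also have "\<dots> \<le> exp (- (4 * y))" using \<open>y \<le> 1\<close> by simp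
    finally show ?thesis .
  next
    assume "real n \<le> 171 * y"
    then have "2 + real n / y \<le> 173" using y by (simp add: field_simps)
    also have "\<dots> \<le> exp (12 :: real)"
    proof -
      have "(173 :: real) \<le> 2 ^ 12" by simp
      also have "\<dots> \<le> exp 1 ^ 12"
        using exp_ge_add_one_self[of "1 :: real"] by (intro power_mono) auto
      also have "\<dots> = exp (12 :: real)" by (simp add: exp_of_nat_mult[symmetric])
      finally show ?thesis .
    qed
    finally have "ln (2 + real n / y) \<le> ln (exp 12)"
      using y by (intro ln_mono) (auto intro: add_pos_nonneg)
    then have "L \<le> 12" by (simp add: L_def)
    then have "48 * y / 12 \<le> 48 * y / L" using y L by (intro divide_left_mono) auto
    moreover have "16 * exp (- 108) \<le> (1 :: real)"
      using e4 exp_le_one_iff[of "- 4 :: real"] by linarith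
    ultimately have "16 * exp (- 108) * exp (- (48 * y / L)) \<le> 1 * exp (- (4 * y))"
      by (intro mult_mono) auto
    then show ?thesis by simp
  qed
  then have "exp (- 108) * exp (- (48 * y / L)) \<le> q * (1 / 2)"
    by (simp add: q_def)
  also have "\<dots> \<le> q * (1 - q)" using q by (intro mult_left_mono) auto
  finally show ?thesis by (simp add: L_def)
qed

theorem proposition1p4:
  "\<exists>c C :: real. c > 0 \<and> C > 0 \<and>
    (\<forall>(K::real) (n::nat) (t::real). K > 0 \<longrightarrow> real n \<ge> C \<longrightarrow> t > 0 \<longrightarrow>
      (\<exists>(M :: (nat \<Rightarrow> real) measure) (X :: nat \<Rightarrow> (nat \<Rightarrow> real) \<Rightarrow> real)
         (f :: (nat \<Rightarrow> real) \<Rightarrow> real).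
         prob_space M \<and>
         prob_space.indep_vars M (\<lambda>_. borel) X {..<n} \<and>
         (\<forall>i<n. subgaussian M K (X i)) \<and>
         convex_fun_Rn n f \<and>
         lipschitz_Rn n 1 f \<and>
         (\<forall>m. is_median M (\<lambda>\<omega>. f (random_vector n X \<omega>)) m \<longrightarrow>
            measure M {\<omega> \<in> space M. f (random_vector n X \<omega>) - m \<ge> t}
              \<ge> c * exp (- (C * t\<^sup>2 / (K\<^sup>2 * ln (2 + K\<^sup>2 * real n / t\<^sup>2)))) \<and>
            measure M {\<omega> \<in> space M. f (random_vector n X \<omega>) - m \<le> - t}
              \<ge> c * exp (- (C * t\<^sup>2 / (K\<^sup>2 * ln (2 + K\<^sup>2 * real n / t\<^sup>2)))))))"
  \<comment> \<open>With \<open>l = 9 + 4 y / ln (2 + n / y)\<close> the norm example has tails of at least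
    \<open>exp (- 12 l) = exp (- 108) exp (- 48 y / ln (2 + n / y))\<close>.\<close>
proof (rule exI[of _ "exp (- 108)"], rule exI[of _ "48"], intro conjI allI impI)
  fix K t :: real and n :: nat
  assume K: "K > 0" and n: "real n \<ge> 48" and t: "t > 0"
  define y where "y = t\<^sup>2 / K\<^sup>2"
  have y: "y > 0" using K t by (simp add: y_def)
  define rate where "rate = exp (- 108) * exp (- (48 * y / ln (2 + real n / y)))"
  have rate_eq: "exp (- 108) * exp (- (48 * t\<^sup>2 / (K\<^sup>2 * ln (2 + K\<^sup>2 * real n / t\<^sup>2)))) = rate"
    unfolding rate_def y_def by (simp add: mult_ac)
  have "\<exists>a q f.
      (\<forall>i<n. subgaussian (scaled_bits a n q) K (coord i)) \<and> convex_fun_Rn n f \<and> lipschitz_Rn n 1 f \<and>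
      (\<forall>m. is_median (scaled_bits a n q) (\<lambda>\<omega>. f (random_vector n coord \<omega>)) m \<longrightarrow>
         measure (scaled_bits a n q)
           {\<omega> \<in> space (scaled_bits a n q). f (random_vector n coord \<omega>) - m \<ge> t} \<ge> rate \<and>
         measure (scaled_bits a n q)
           {\<omega> \<in> space (scaled_bits a n q). f (random_vector n coord \<omega>) - m \<le> - t} \<ge> rate)"
  proof (cases "y \<le> 1 \<or> real n \<le> 171 * y")
    case True
    \<comment> \<open>The exponential compensates \<open>exp (a\<^sup>2 / K\<^sup>2) = exp (4 y)\<close> for \<open>a = 2 t\<close>; the factor
      \<open>1 / 8\<close> keeps the median at \<open>0\<close> even for small \<open>y\<close>.\<close>
    define q where "q = exp (- (4 * y)) / 8"
    have q: "0 \<le> q" "q \<le> 1 / 8" using y by (auto simp: q_def)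
    have "(2 * t)\<^sup>2 / K\<^sup>2 = 4 * y" by (simp add: y_def power_mult_distrib)
    moreover have "q * exp (4 * y) = 1 / 8"
      by (simp add: q_def exp_minus)
    ultimately have "q * (exp ((2 * t)\<^sup>2 / K\<^sup>2) - 1) \<le> 1"
      using q by (simp add: right_diff_distrib)
    then have sub: "\<forall>i<n. subgaussian (scaled_bits (2 * t) n q) K (coord i)"
      using K q by (intro allI impI subgaussian_scaled_bits) auto
    have le: "rate \<le> q * (1 - q)"
      unfolding rate_def q_def by (rule extreme_deviation_rate[OF y True])
    have n2: "n \<ge> 2" using n by simp
    show ?thesis
      by (intro exI[of _ "2 * t"] exI[of _ q] exI[of _ half_difference] conjI allI impI sub
            convex_fun_Rn_half_difference[OF n2] lipschitz_Rn_half_difference[OF n2];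
          rule order.trans[OF le half_difference_scaled_bits_tails(1)[OF n2 q t]]
               order.trans[OF le half_difference_scaled_bits_tails(2)[OF n2 q t]])
  next
    case False
    define r where "r = real n / y"
    define l where "l = 9 + 4 * y / ln (2 + r)"
    define q where "q = l / real n"
    \<comment> \<open>The height is determined by \<open>q exp (a\<^sup>2 / K\<^sup>2) = 1\<close>.\<close>
    define a where "a = K * sqrt (ln (real n / l))"
    have y1: "y \<ge> 1" and r: "r \<ge> 171" using False by (auto simp: r_def field_simps)
    have ry: "r * y = real n" using y by (simp add: r_def)
    have "ln (2 + r) > 0" using r by simp
    then have l: "l \<ge> 9" using y by (simp add: l_def)
    have n10: "10 * l \<le> real n" and ln_ge: "2 * y / l \<le> ln (real n / l)"
      using rate_parameter[OF y1 r] by (simp_all only: l_def ry)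
    have npos: "real n > 0" using n by simp
    have q: "0 \<le> q" "q \<le> 1 / 10" "l = real n * q"
      using n10 l npos by (simp_all add: q_def divide_le_eq)
    have "0 < 2 * y / l" using y l by simp
    with ln_ge have ln_pos: "0 < ln (real n / l)" by linarith
    have a: "a > 0" unfolding a_def using K ln_pos by (intro mult_pos_pos) auto
    have "a\<^sup>2 / K\<^sup>2 = ln (real n / l)"
      using K ln_pos by (simp add: a_def power_mult_distrib)
    moreover have "exp (ln (real n / l)) = real n / l"
      using l npos by (intro exp_ln) auto
    moreover have "q * (real n / l) = 1" using l npos by (simp add: q_def)
    ultimately have "q * (exp (a\<^sup>2 / K\<^sup>2) - 1) \<le> 1"
      using q by (simp only: right_diff_distrib)
    then have sub: "\<forall>i<n. subgaussian (scaled_bits a n q) K (coord i)"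
      using K q by (intro allI impI subgaussian_scaled_bits) auto
    have "2 * y \<le> ln (real n / l) * l"
      using ln_ge l by (simp only: pos_divide_le_eq)
    then have y_le: "y \<le> ln (real n / l) * (l / 2)" by simp
    have "t\<^sup>2 = K\<^sup>2 * y" using K by (simp add: y_def)
    also have "\<dots> \<le> K\<^sup>2 * (ln (real n / l) * (l / 2))"
      using y_le by (intro mult_left_mono) auto
    also have "\<dots> = (a * sqrt (l / 2))\<^sup>2"
      using ln_pos l by (simp add: a_def power_mult_distrib)
    finally have t_sq_le: "t\<^sup>2 \<le> (a * sqrt (l / 2))\<^sup>2" .
    have t_le: "t \<le> a * sqrt (l / 2)"
    proof (rule power2_le_imp_le[OF t_sq_le])
      show "0 \<le> a * sqrt (l / 2)"
        using a l by (intro mult_nonneg_nonneg) auto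
    qed
    have rate_l: "rate = exp (- (12 * l))"
      by (simp add: rate_def l_def r_def exp_add[symmetric])
    show ?thesis
      unfolding rate_l
      by (intro exI[of _ a] exI[of _ q] exI[of _ "\<lambda>x. L2_set x {..<n}"] conjI allI impI sub
            convex_fun_Rn_L2_set lipschitz_Rn_L2_set;
          rule norm_scaled_bits_tails[OF q l a t t_le])
  qed
  then obtain a q f where
      "\<forall>i<n. subgaussian (scaled_bits a n q) K (coord i)" "convex_fun_Rn n f" "lipschitz_Rn n 1 f"
      "\<forall>m. is_median (scaled_bits a n q) (\<lambda>\<omega>. f (random_vector n coord \<omega>)) m \<longrightarrow>
         measure (scaled_bits a n q)
           {\<omega> \<in> space (scaled_bits a n q). f (random_vector n coord \<omega>) - m \<ge> t} \<ge> rate \<and>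
         measure (scaled_bits a n q)
           {\<omega> \<in> space (scaled_bits a n q). f (random_vector n coord \<omega>) - m \<le> - t} \<ge> rate"
    by auto
  then show "\<exists>(M :: (nat \<Rightarrow> real) measure) (X :: nat \<Rightarrow> (nat \<Rightarrow> real) \<Rightarrow> real)
         (f :: (nat \<Rightarrow> real) \<Rightarrow> real).
         prob_space M \<and>
         prob_space.indep_vars M (\<lambda>_. borel) X {..<n} \<and>
         (\<forall>i<n. subgaussian M K (X i)) \<and>
         convex_fun_Rn n f \<and>
         lipschitz_Rn n 1 f \<and>
         (\<forall>m. is_median M (\<lambda>\<omega>. f (random_vector n X \<omega>)) m \<longrightarrow>
            measure M {\<omega> \<in> space M. f (random_vector n X \<omega>) - m \<ge> t}
              \<ge> exp (- 108) * exp (- (48 * t\<^sup>2 / (K\<^sup>2 * ln (2 + K\<^sup>2 * real n / t\<^sup>2)))) \<and>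
            measure M {\<omega> \<in> space M. f (random_vector n X \<omega>) - m \<le> - t}
              \<ge> exp (- 108) * exp (- (48 * t\<^sup>2 / (K\<^sup>2 * ln (2 + K\<^sup>2 * real n / t\<^sup>2)))))"
    unfolding rate_eq
    by (intro exI[of _ "measure_pmf (scaled_bits a n q)"] exI[of _ coord] exI[of _ f] conjI
          prob_space_measure_pmf indep_vars_scaled_bits)
qed simp_all

end
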